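(* Let $\{x_0^k\}_{k\ge1}$ be generated by the 2-level MGProx algorithm (see context) from an initial guess $x_0^1\in\mathbb{R}^{n_0}$. Let $x_0^*=\mathrm{argmin}\,F_0$ and $F_0^*=F_0(x_0^* )$. Then for all $k\ge1$ $$F_0(x_0^{k+1})-F_0^*\;\le\;\Big(1-\frac{\mu_0}{L_0}\Big)^k\big(F_0(x_0^1)-F_0^*\big).$$
   Context: Problem: minimize $F_0(x)=f_0(x)+g_0(x)$ over $x\in\mathbb{R}^{n_0}$. Here $f_0:\mathbb{R}^{n_0}\to\mathbb{R}$ is $L_0$-smooth (differentiable with $L_0$-Lipschitz gradient) and $\mu_0$-strongly convex, $\mu_0>0$ (i.e. $f_0-\frac{\mu_0}{2}\|\cdot\|_2^2$ is convex); $g_0:\mathbb{R}^{n_0}\to\mathbb{R}$ is proper, convex, possibly nonsmooth and separable, $g_0(x)=\sum_i g_{0,i}(x_i)$, with a single point of nondifferentiability (each $g_{0,i}$ is nondifferentiable at at most one point). $\partial$ denotes the convex subdifferential. Coarse functions: let $n_1\le n_0$ and let $Q\in\mathbb{R}^{n_0\times n_1}$ have rank $n_1$. Put $f_1=f_0\circ Q$, $g_1=g_0\circ Q$, $F_1=f_1+g_1=F_0\circ Q:\mathbb{R}^{n_1}\to\mathbb{R}$. Adaptive restriction and prolongation: given a full restriction matrix $\overline{R}\in\mathbb{R}^{n_1\times n_0}$, for $y\in\mathbb{R}^{n_0}$ the adaptive restriction matrix $R(y)$ is obtained from $\overline{R}$ by setting to zero every column $i$ for which $\partial g_{0,i}(y_i)$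 is not a singleton. Thus $R(y)\,\partial F_0(y)$ is a singleton. The associated prolongation is $P=c\,R(y)^\top$ with a fixed constant $c>0$. Proximal operator: $\mathrm{prox}_{\beta g}(x)=\mathrm{argmin}_u\{\beta g(u)+\frac12\|u-x\|_2^2\}$. 2-level MGProx: for $k=1,2,\dots$, given $x_0^k$, (i) $y_0^{k+1}=\mathrm{prox}_{\frac1{L_0}g_0}\big(x_0^k-\frac1{L_0}\nabla f_0(x_0^k)\big)$; (ii) $y_1^{k+1}=R(y_0^{k+1})\,y_0^{k+1}$; (iii) choose any $\tau_{0\to1}^{k+1}\in \partial F_1(y_1^{k+1})-R(y_0^{k+1})\,\partial F_0(y_0^{k+1})$; (iv) $x_1^{k+1}=\mathrm{argmin}_{\xi\in\mathbb{R}^{n_1}}\{F_1(\xi)-\langle\tau_{0\to1}^{k+1},\xi\rangle\}$; (v) $z_0^{k+1}=y_0^{k+1}+\alpha P(x_1^{k+1}-y_1^{k+1})$ with $P=c\,R(y_0^{k+1})^\top$; (vi) $x_0^{k+1}=\mathrm{prox}_{\frac1{L_0}g_0}\big(z_0^{k+1}-\frac1{L_0}\nabla f_0(z_0^{k+1})\big)$. The stepsize $\alpha$ in (v) is chosen at each iteration by backtracking: starting from some $\alpha>0$, $\alpha$ is halved until $F_0(y_0^{k+1}+\alpha P(x_1^{k+1}-y_1^{k+1}))\le F_0(y_0^{k+1})$; if $\alpha$ falls below a fixed tolerance $\epsilon>0$ first, one sets $z_0^{k+1}=y_0^{k+1}$. In particular $F_0(z_0^{k+1})\le F_0(y_0^{k+1})$.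 *)

theory Defs
  imports "HOL-Analysis.Analysis"
begin

definition gradient :: "('a::real_inner \<Rightarrow> real) \<Rightarrow> 'a \<Rightarrow> 'a" where
  "gradient f x = (THE D. GDERIV f x :> D)"

definition L_smooth :: "real \<Rightarrow> ('a::real_inner \<Rightarrow> real) \<Rightarrow> bool" where
  "L_smooth L f \<longleftrightarrow> (\<forall>x. f differentiable (at x)) \<and> L-lipschitz_on UNIV (gradient f)"

definition strongly_convex :: "real \<Rightarrow> ('a::real_inner \<Rightarrow> real) \<Rightarrow> bool" where
  "strongly_convex \<mu> f \<longleftrightarrow> convex_on UNIV (\<lambda>x. f x - \<mu> / 2 * (norm x)\<^sup>2)"

definition subdiff :: "('a::real_inner \<Rightarrow> real) \<Rightarrow> 'a \<Rightarrow> 'a set" where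
  "subdiff f x = {v. \<forall>y. f y \<ge> f x + v \<bullet> (y - x)}"

(* arg_min chooses some minimiser; in every use below the objective is strongly convex
   and real-valued, so the minimiser exists and is unique. *)
abbreviation argmin :: "('a \<Rightarrow> real) \<Rightarrow> 'a" where
  "argmin f \<equiv> arg_min f (\<lambda>_. True)"

definition prox :: "real \<Rightarrow> ('a::real_inner \<Rightarrow> real) \<Rightarrow> 'a \<Rightarrow> 'a" where
  "prox \<beta> g x = argmin (\<lambda>u. \<beta> * g u + 1 / 2 * (norm (u - x))\<^sup>2)"

definition prox_grad :: "real \<Rightarrow> ('a::real_inner \<Rightarrow> real) \<Rightarrow> ('a \<Rightarrow> real) \<Rightarrow> 'a \<Rightarrow> 'a" where
  "prox_grad L f g x = prox (1 / L) g (x - (1 / L) *\<^sub>R gradient f x)"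

(* A matrix of type real^'n0^'n1 has rows indexed by 'n1 and columns indexed by 'n0. *)
definition adaptive_restriction ::
  "('n0 \<Rightarrow> real \<Rightarrow> real) \<Rightarrow> real^'n0^'n1 \<Rightarrow> real^'n0 \<Rightarrow> real^'n0^'n1" where
  "adaptive_restriction g Rbar y =
     (\<chi> j i. if is_singleton (subdiff (g i) (y $ i)) then Rbar $ j $ i else 0)"

(* The trial stepsizes are \<alpha>, \<alpha>/2, \<alpha>/4, ...; the first one that does not increase F is
   taken, unless the stepsize drops below \<epsilon> before that, in which case the result is y. *)
definition backtrack ::
  "('a::real_vector \<Rightarrow> real) \<Rightarrow> 'a \<Rightarrow> 'a \<Rightarrow> real \<Rightarrow> real \<Rightarrow> 'a" where
  "backtrack F y d \<alpha> \<epsilon> =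
     (let ok = (\<lambda>j::nat. \<epsilon> \<le> \<alpha> / 2 ^ j \<and> F (y + (\<alpha> / 2 ^ j) *\<^sub>R d) \<le> F y)
      in if \<exists>j. ok j then y + (\<alpha> / 2 ^ (LEAST j. ok j)) *\<^sub>R d else y)"

(* One iteration x \<mapsto> x'.  It is a relation because the selection \<tau> and the initial trial
   stepsize \<alpha> may be chosen freely in each iteration. *)
definition mgprox_step ::
  "real \<Rightarrow> (real^'n0 \<Rightarrow> real) \<Rightarrow> (real^'n0 \<Rightarrow> real) \<Rightarrow> ('n0 \<Rightarrow> real \<Rightarrow> real) \<Rightarrow>
   real^'n1^'n0 \<Rightarrow> real^'n0^'n1 \<Rightarrow> real \<Rightarrow> real \<Rightarrow> real^'n0 \<Rightarrow> real^'n0 \<Rightarrow> bool" where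
  "mgprox_step L0 f0 g0 g Q Rbar c \<epsilon> x x' \<longleftrightarrow>
     (\<exists>\<alpha> \<tau>. \<alpha> > 0 \<and>
       (let F0 = (\<lambda>u. f0 u + g0 u);
            F1 = (\<lambda>\<xi>. F0 (Q *v \<xi>));
            y0 = prox_grad L0 f0 g0 x;
            R = adaptive_restriction g Rbar y0;
            P = c *\<^sub>R transpose R;
            y1 = R *v y0;
            x1 = argmin (\<lambda>\<xi>. F1 \<xi> - \<tau> \<bullet> \<xi>);
            z0 = backtrack F0 y0 (P *v (x1 - y1)) \<alpha> \<epsilon>
        in \<tau> \<in> {u - R *v v | u v. u \<in> subdiff F1 y1 \<and> v \<in> subdiff F0 y0} \<and>
           x' = prox_grad L0 f0 g0 z0))"

end

theory Submission
  imports Defs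
begin

text \<open>Let \<open>y\<close> be the proximal gradient step from \<open>x\<close>. By the descent lemma, \<open>F y\<close> is at most the
  minimum over \<open>u\<close> of the model \<open>f x + \<nabla>f x \<bullet> (u - x) + L/2 |u - x|\<^sup>2 + g u\<close>. Evaluating the model at
  \<open>u = x + (\<mu>/L) (w - x)\<close> and using convexity of \<open>g\<close> and strong convexity of \<open>f\<close> gives
  \<open>F y - F w \<le> (1 - \<mu>/L) (F x - F w)\<close> for every \<open>w\<close>; evaluating it at \<open>u = x\<close> gives \<open>F y \<le> F x\<close>.
  As the coarse correction does not increase \<open>F\<close>, the post-smoothing step alone yields the rate.\<close>

section \<open>Gradients, and the quadratic bounds from smoothness and strong convexity\<close>

lemma GDERIV_gradient:
  fixes f :: "'a::euclidean_space \<Rightarrow> real"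
  assumes "f differentiable (at x)"
  shows "GDERIV f x :> gradient f x"
proof -
  obtain f' where f': "(f has_derivative f') (at x)"
    using assms by (auto simp: differentiable_def)
  interpret f': linear f'
    using f' by (rule has_derivative_linear)
  \<comment> \<open>\<open>D\<close> is the Riesz representer of the derivative \<open>f'\<close>,
    assembled coordinatewise.\<close>
  define D where "D = (\<Sum>b\<in>Basis. f' b *\<^sub>R b)"
  have "f' h = h \<bullet> D" for h
  proof -
    have "f' h = f' (\<Sum>b\<in>Basis. (h \<bullet> b) *\<^sub>R b)"
      by (simp add: euclidean_representation)
    also have "\<dots> = h \<bullet> D"
      by (simp add: f'.sum f'.scaleR D_def inner_sum_right mult.commute)
    finally show ?thesis .
  qed
  then have "f' = (\<lambda>h. h \<bullet> D)"
    by blast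
  with f' have D: "GDERIV f x :> D"
    by (simp add: gderiv_def)
  \<comment> \<open>\<open>gradient\<close> is a definite description, so uniqueness is required
    too. Two representers agree on every vector, in particular on \<open>E - D\<close>.\<close>
  have "E = D" if "GDERIV f x :> E" for E
  proof -
    have "(\<lambda>h. h \<bullet> E) = (\<lambda>h. h \<bullet> D)"
      using that D unfolding gderiv_def by (rule has_derivative_unique)
    then have "(E - D) \<bullet> E = (E - D) \<bullet> D"
      by meson
    then have "(E - D) \<bullet> (E - D) = 0"
      by (simp add: inner_diff_right)
    then show ?thesis
      by simp
  qed
  with D show ?thesis
    unfolding gradient_def by (rule theI)
qed

lemma GDERIV_along_line:
  assumes "GDERIV f (x + s *\<^sub>R d) :> D"
  shows "((\<lambda>s. f (x + s *\<^sub>R d)) has_real_derivative d \<bullet> D) (at s)"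
proof -
  have "((\<lambda>s. x + s *\<^sub>R d) has_derivative (\<lambda>h. h *\<^sub>R d)) (at s)"
    by (auto intro!: derivative_eq_intros)
  from has_derivative_compose[OF this] assms
  have "((\<lambda>s. f (x + s *\<^sub>R d)) has_derivative (\<lambda>h. (h *\<^sub>R d) \<bullet> D)) (at s)"
    unfolding gderiv_def by blast
  moreover have "(\<lambda>h. (h *\<^sub>R d) \<bullet> D) = (*) (d \<bullet> D)"
    by (simp add: fun_eq_iff)
  ultimately show ?thesis
    by (simp only: has_field_derivative_def)
qed

text \<open>Along the segment from \<open>x\<close> to \<open>y\<close>, \<open>\<phi>\<close> is
  \<open>f\<close> minus the linear and quadratic terms of the bound. The Lipschitz condition bounds
  the change of gradient at parameter \<open>s\<close> by \<open>L * s * norm d\<close>, so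
  \<open>\<phi>\<close> has nonpositive derivative on [0, 1].\<close>

lemma L_smooth_descent:
  fixes f :: "'a::euclidean_space \<Rightarrow> real"
  assumes "L_smooth L f"
  shows "f y \<le> f x + gradient f x \<bullet> (y - x) + L / 2 * (norm (y - x))\<^sup>2"
proof -
  define d where "d = y - x"
  define \<phi> where "\<phi> s = f (x + s *\<^sub>R d) - s * (d \<bullet> gradient f x) - L / 2 * s\<^sup>2 * (norm d)\<^sup>2" for s
  have lip: "L-lipschitz_on UNIV (gradient f)"
    and diff: "f differentiable (at u)" for u
    using assms by (auto simp: L_smooth_def)
  have "\<phi> 1 \<le> \<phi> 0"
  proof (rule DERIV_nonpos_imp_nonincreasing[where f = \<phi>])
    fix s :: real
    assume s: "0 \<le> s" "s \<le> 1"
    let ?G = "gradient f (x + s *\<^sub>R d)"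
    have "(\<phi> has_real_derivative d \<bullet> ?G - d \<bullet> gradient f x - L * s * (norm d)\<^sup>2) (at s)"
      unfolding \<phi>_def
      by (auto intro!: derivative_eq_intros GDERIV_along_line GDERIV_gradient diff)
    moreover have "d \<bullet> ?G - d \<bullet> gradient f x \<le> L * s * (norm d)\<^sup>2"
    proof -
      have "d \<bullet> ?G - d \<bullet> gradient f x \<le> norm d * norm (?G - gradient f x)"
        unfolding inner_diff_right[symmetric] by (rule norm_cauchy_schwarz)
      also have "\<dots> \<le> norm d * (L * norm (s *\<^sub>R d))"
        using lipschitz_onD[OF lip, of "x + s *\<^sub>R d" x]
        by (intro mult_left_mono) (auto simp: dist_norm)
      finally show ?thesis
        using s by (simp add: power2_eq_square algebra_simps)
    qed
    ultimately show "\<exists>y. DERIV \<phi> s :> y \<and> y \<le> 0"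
      by (intro exI conjI) auto
  qed simp
  then show ?thesis
    by (simp add: \<phi>_def d_def inner_commute)
qed

text \<open>The convex function \<open>h\<close>, that is \<open>f\<close> without its quadratic
  part, lies above its tangent along the line through \<open>x\<close> and \<open>y\<close>.
  Expanding the squared norm of \<open>x + s *\<^sub>R d\<close> turns the removed part back into
  the square of \<open>norm (y - x)\<close>.\<close>

lemma strongly_convex_above_tangent:
  fixes f :: "'a::euclidean_space \<Rightarrow> real"
  assumes conv: "strongly_convex \<mu> f" and diff: "f differentiable (at x)"
  shows "f x + gradient f x \<bullet> (y - x) + \<mu> / 2 * (norm (y - x))\<^sup>2 \<le> f y"
proof -
  define d where "d = y - x"
  define h where "h u = f u - \<mu> / 2 * (norm u)\<^sup>2" for u
  define \<phi> where "\<phi> s = h (x + s *\<^sub>R d)" for s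
  have h: "convex_on UNIV h"
    using conv by (simp add: strongly_convex_def h_def[abs_def])
  have "convex_on UNIV \<phi>"
  proof (rule convex_onI)
    fix t a b :: real
    assume "0 < t" "t < 1"
    then have "h ((1 - t) *\<^sub>R (x + a *\<^sub>R d) + t *\<^sub>R (x + b *\<^sub>R d)) \<le> (1 - t) * \<phi> a + t * \<phi> b"
      unfolding \<phi>_def by (intro convex_onD[OF h]) auto
    moreover have "(1 - t) *\<^sub>R (x + a *\<^sub>R d) + t *\<^sub>R (x + b *\<^sub>R d) =
        x + ((1 - t) *\<^sub>R a + t *\<^sub>R b) *\<^sub>R d"
      by (simp add: algebra_simps)
    ultimately show "\<phi> ((1 - t) *\<^sub>R a + t *\<^sub>R b) \<le> (1 - t) * \<phi> a + t * \<phi> b"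
      by (simp add: \<phi>_def)
  qed simp
  have \<phi>: "\<phi> s = f (x + s *\<^sub>R d) - \<mu> / 2 * ((norm x)\<^sup>2 + 2 * s * (x \<bullet> d) + s\<^sup>2 * (norm d)\<^sup>2)" for s
    unfolding \<phi>_def h_def power2_norm_eq_inner inner_add_left inner_add_right
    by (simp add: inner_commute power2_eq_square)
  have "(\<phi> has_real_derivative d \<bullet> gradient f x - \<mu> * (x \<bullet> d)) (at 0)"
    unfolding \<phi>[abs_def] using GDERIV_gradient[OF diff]
    by (auto intro!: derivative_eq_intros GDERIV_along_line)
  then have "\<phi> 1 - \<phi> 0 \<ge> (d \<bullet> gradient f x - \<mu> * (x \<bullet> d)) * (1 - 0)"
    using \<open>convex_on UNIV \<phi>\<close> by (intro convex_on_imp_above_tangent[where A = UNIV]) auto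
  then show ?thesis
    by (simp add: \<phi> d_def inner_commute algebra_simps)
qed

text \<open>At distance 1 from the origin, the lower and upper quadratic bounds share their linear
  part and differ only in \<open>\<mu> / 2\<close> against \<open>L / 2\<close>. This makes
  \<open>L\<close> positive and the contraction factor nonnegative when
  \<open>\<mu> > 0\<close>.\<close>

lemma smooth_strongly_convex_le:
  fixes f :: "'a::euclidean_space \<Rightarrow> real"
  assumes "L_smooth L f" "strongly_convex \<mu> f"
  shows "\<mu> \<le> L"
proof -
  obtain b :: 'a where b: "b \<in> Basis"
    using nonempty_Basis by blast
  have "f differentiable (at 0)"
    using assms(1) by (simp add: L_smooth_def)
  with strongly_convex_above_tangent[OF assms(2), of 0 b] L_smooth_descent[OF assms(1), of b 0] b
  show ?thesis
    by simp
qed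

section \<open>The proximal operator and the proximal gradient step\<close>

lemma prox_minimizes:
  fixes g :: "'a::euclidean_space \<Rightarrow> real"
  assumes conv: "convex_on UNIV g" and "\<beta> \<ge> 0"
  shows "\<beta> * g (prox \<beta> g x) + 1 / 2 * (norm (prox \<beta> g x - x))\<^sup>2
    \<le> \<beta> * g u + 1 / 2 * (norm (u - x))\<^sup>2"
proof -
  define \<phi> where "\<phi> u = \<beta> * g u + 1 / 2 * (norm (u - x))\<^sup>2" for u
  have g: "continuous_on S g" for S
    using convex_on_continuous[OF open_UNIV conv] continuous_on_subset by blast
  have \<phi>: "continuous_on S \<phi>" for S
    unfolding \<phi>_def by (intro continuous_intros g)
  \<comment> \<open>The minimum of \<open>g\<close> on the unit ball controls \<open>g\<close> far
    away: by convexity, \<open>g\<close> falls below \<open>g x\<close> at most linearly in the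
    distance from \<open>x\<close>, with slope \<open>g x - g m\<close>.\<close>
  obtain m where m: "m \<in> cball x 1" "\<And>v. v \<in> cball x 1 \<Longrightarrow> g m \<le> g v"
    using continuous_attains_inf[OF compact_cball _ g, of x 1] by auto
  \<comment> \<open>Beyond radius \<open>r\<close> the term \<open>s * s / 2\<close> outweighs this
    linear drop scaled by \<open>\<beta>\<close>. The lower bound 1 puts the unit ball within radius
    \<open>r\<close>.\<close>
  define r where "r = max 1 (2 * \<beta> * (g x - g m))"
  have "r \<ge> 1"
    by (simp add: r_def)
  obtain p where p: "p \<in> cball x r" "\<And>v. v \<in> cball x r \<Longrightarrow> \<phi> p \<le> \<phi> v"
    using continuous_attains_inf[OF compact_cball _ \<phi>, of x r] \<open>r \<ge> 1\<close> by auto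
  have "\<phi> p \<le> \<phi> v" for v
  proof (cases "v \<in> cball x r")
    case False
    define s where "s = norm (v - x)"
    have s: "s > r" "s > 1"
      using False \<open>r \<ge> 1\<close> by (auto simp: s_def dist_norm norm_minus_commute)
    \<comment> \<open>The segment from \<open>x\<close> to \<open>v\<close> leaves the unit ball at
      this point, where \<open>g m\<close> is a lower bound.\<close>
    have "(1 - 1 / s) *\<^sub>R x + (1 / s) *\<^sub>R v = x + (1 / s) *\<^sub>R (v - x)"
      by (simp add: algebra_simps)
    moreover have "x + (1 / s) *\<^sub>R (v - x) \<in> cball x 1"
      using s by (simp add: dist_norm s_def)
    ultimately have "g m \<le> g ((1 - 1 / s) *\<^sub>R x + (1 / s) *\<^sub>R v)"
      using m(2) by simp
    also have "\<dots> \<le> (1 - 1 / s) * g x + 1 / s * g v"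
      using s by (intro convex_onD[OF conv]) auto
    finally have "s * g m \<le> s * ((1 - 1 / s) * g x + 1 / s * g v)"
      using s by simp
    also have "\<dots> = (s - 1) * g x + g v"
      using s by (simp add: field_simps)
    finally have "g x - g v \<le> s * (g x - g m)"
      by (simp add: algebra_simps)
    then have "\<beta> * (g x - g v) \<le> \<beta> * (s * (g x - g m))"
      using \<open>\<beta> \<ge> 0\<close> by (rule mult_left_mono)
    also have "\<dots> = s * (2 * \<beta> * (g x - g m)) / 2"
      by simp
    also have "\<dots> \<le> s * s / 2"
      using s by (intro divide_right_mono mult_left_mono) (auto simp: r_def)
    finally have "\<phi> x \<le> \<phi> v"
      by (simp add: \<phi>_def s_def power2_eq_square algebra_simps)
    moreover have "\<phi> p \<le> \<phi> x"
      using p(2) \<open>r \<ge> 1\<close> by simp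
    ultimately show ?thesis
      by simp
  qed (use p in simp)
  \<comment> \<open>Since a minimiser exists, the choice made by \<open>argmin\<close> is a
    minimiser as well.\<close>
  then have "is_arg_min \<phi> (\<lambda>_. True) p"
    by (auto simp: is_arg_min_def not_less)
  then have "is_arg_min \<phi> (\<lambda>_. True) (argmin \<phi>)"
    unfolding arg_min_def by (rule someI)
  moreover have "prox \<beta> g x = argmin \<phi>"
    by (simp add: prox_def \<phi>_def[abs_def])
  ultimately show ?thesis
    by (auto simp: is_arg_min_def \<phi>_def not_less)
qed

text \<open>Completing the square shows that \<open>L\<close> times the proximal objective is the
  linearised model up to a constant independent of \<open>u\<close>. The proximal step therefore
  minimises the model, which dominates \<open>f + g\<close> by the descent lemma.\<close>

lemma prox_grad_le_model:
  fixes f g :: "'a::euclidean_space \<Rightarrow> real"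
  assumes smooth: "L_smooth L f" and "L > 0" and conv: "convex_on UNIV g"
  shows "f (prox_grad L f g x) + g (prox_grad L f g x)
    \<le> f x + gradient f x \<bullet> (u - x) + L / 2 * (norm (u - x))\<^sup>2 + g u"
proof -
  define y where "y = prox_grad L f g x"
  define G where "G = gradient f x"
  have complete_square: "L * (1 / L * g v + 1 / 2 * (norm (v - (x - (1 / L) *\<^sub>R G)))\<^sup>2) =
      g v + G \<bullet> (v - x) + L / 2 * (norm (v - x))\<^sup>2 + (norm G)\<^sup>2 / (2 * L)" for v
  proof -
    have "v - (x - (1 / L) *\<^sub>R G) = (v - x) + (1 / L) *\<^sub>R G"
      by simp
    then have "(norm (v - (x - (1 / L) *\<^sub>R G)))\<^sup>2 =
        (norm (v - x))\<^sup>2 + 2 / L * (G \<bullet> (v - x)) + (norm G)\<^sup>2 / L\<^sup>2"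
      by (simp only: power2_norm_eq_inner inner_add_left inner_add_right
          inner_scaleR_left inner_scaleR_right)
        (simp add: inner_commute power2_eq_square add_divide_distrib)
    then show ?thesis
      using \<open>L > 0\<close> by (simp add: field_simps power2_eq_square)
  qed
  have "L * (1 / L * g y + 1 / 2 * (norm (y - (x - (1 / L) *\<^sub>R G)))\<^sup>2)
      \<le> L * (1 / L * g u + 1 / 2 * (norm (u - (x - (1 / L) *\<^sub>R G)))\<^sup>2)"
    unfolding y_def G_def prox_grad_def using \<open>L > 0\<close>
    by (intro mult_left_mono prox_minimizes[OF conv]) auto
  then have "g y + G \<bullet> (y - x) + L / 2 * (norm (y - x))\<^sup>2
      \<le> g u + G \<bullet> (u - x) + L / 2 * (norm (u - x))\<^sup>2"
    unfolding complete_square by simp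
  with L_smooth_descent[OF smooth, of y x] show ?thesis
    by (simp add: y_def G_def)
qed

lemma prox_grad_decrease:
  fixes f g :: "'a::euclidean_space \<Rightarrow> real"
  assumes "L_smooth L f" "L > 0" "convex_on UNIV g"
  shows "f (prox_grad L f g x) + g (prox_grad L f g x) \<le> f x + g x"
  using prox_grad_le_model[OF assms, of x x] by simp

lemma prox_grad_contraction:
  fixes f g :: "'a::euclidean_space \<Rightarrow> real"
  assumes smooth: "L_smooth L f" and "\<mu> > 0" and sc: "strongly_convex \<mu> f"
    and conv: "convex_on UNIV g"
  shows "f (prox_grad L f g x) + g (prox_grad L f g x) - (f w + g w)
    \<le> (1 - \<mu> / L) * (f x + g x - (f w + g w))"
proof -
  \<comment> \<open>With this step length the quadratic term of the model, of order
    \<open>t\<^sup>2\<close>, becomes \<open>t\<close> times the strong convexity term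
    \<open>\<mu> / 2 * (norm d)\<^sup>2\<close>, so the tangent bound at \<open>w\<close> absorbs it
    exactly.\<close>
  define t where "t = \<mu> / L"
  define d where "d = w - x"
  have L: "\<mu> \<le> L" "L > 0"
    using smooth_strongly_convex_le[OF smooth sc] \<open>\<mu> > 0\<close> by auto
  then have t: "0 \<le> t" "t \<le> 1" and Lt: "L * t = \<mu>"
    using \<open>\<mu> > 0\<close> by (auto simp: t_def)
  have "f (prox_grad L f g x) + g (prox_grad L f g x)
      \<le> f x + t * (gradient f x \<bullet> d) + L / 2 * (t * norm d)\<^sup>2 + g (x + t *\<^sub>R d)"
    using prox_grad_le_model[OF smooth L(2) conv, of x "x + t *\<^sub>R d"] t by simp
  also have "L / 2 * (t * norm d)\<^sup>2 = t * (\<mu> / 2 * (norm d)\<^sup>2)"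
    unfolding Lt[symmetric] by (simp add: power2_eq_square)
  also have "x + t *\<^sub>R d = (1 - t) *\<^sub>R x + t *\<^sub>R w"
    by (simp add: d_def algebra_simps)
  also have "g \<dots> \<le> (1 - t) * g x + t * g w"
    using t by (intro convex_onD[OF conv]) auto
  finally have "f (prox_grad L f g x) + g (prox_grad L f g x)
      \<le> f x + t * (gradient f x \<bullet> d + \<mu> / 2 * (norm d)\<^sup>2) + ((1 - t) * g x + t * g w)"
    by (simp add: algebra_simps)
  moreover have "t * (gradient f x \<bullet> d + \<mu> / 2 * (norm d)\<^sup>2) \<le> t * (f w - f x)"
    using strongly_convex_above_tangent[OF sc, of x w] smooth t
    by (intro mult_left_mono) (simp_all add: L_smooth_def d_def)
  ultimately show ?thesis
    by (simp add: t_def[symmetric] algebra_simps)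
qed

section \<open>The 2-level iteration and its linear rate\<close>

lemma backtrack_le: "F (backtrack F y d \<alpha> \<epsilon>) \<le> F y"
proof -
  define ok where "ok j \<longleftrightarrow> \<epsilon> \<le> \<alpha> / 2 ^ j \<and> F (y + (\<alpha> / 2 ^ j) *\<^sub>R d) \<le> F y" for j :: nat
  have "backtrack F y d \<alpha> \<epsilon> = (if \<exists>j. ok j then y + (\<alpha> / 2 ^ (LEAST j. ok j)) *\<^sub>R d else y)"
    unfolding backtrack_def Let_def ok_def ..
  \<comment> \<open>If no exponent is admissible, backtracking returns \<open>y\<close> and the
    bound is an equality.\<close>
  moreover have "ok (LEAST j. ok j)" if "\<exists>j. ok j"
    using that by (rule LeastI_ex)
  ultimately show ?thesis
    by (simp add: ok_def)
qed

lemma mgprox_step_contraction: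
  fixes f0 g0 :: "real^'n0 \<Rightarrow> real" and Q :: "real^'n1^'n0"
  assumes smooth: "L_smooth L0 f0" and "\<mu>0 > 0" and sc: "strongly_convex \<mu>0 f0"
    and conv: "convex_on UNIV g0"
    and step: "mgprox_step L0 f0 g0 g Q Rbar c \<epsilon> x x'"
  shows "f0 x' + g0 x' - (f0 w + g0 w) \<le> (1 - \<mu>0 / L0) * (f0 x + g0 x - (f0 w + g0 w))"
proof -
  define F where "F u = f0 u + g0 u" for u
  define y where "y = prox_grad L0 f0 g0 x"
  have L: "\<mu>0 \<le> L0" "L0 > 0"
    using smooth_strongly_convex_le[OF smooth sc] \<open>\<mu>0 > 0\<close> by auto
  \<comment> \<open>Here \<open>d\<close> stands for the prolonged coarse correction
    \<open>P *v (x1 - y1)\<close>.\<close>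
  obtain d \<alpha> where x': "x' = prox_grad L0 f0 g0 (backtrack F y d \<alpha> \<epsilon>)"
    using step unfolding mgprox_step_def Let_def F_def[abs_def] y_def by blast
  have "F x' - F w \<le> (1 - \<mu>0 / L0) * (F (backtrack F y d \<alpha> \<epsilon>) - F w)"
    unfolding x' F_def by (rule prox_grad_contraction[OF smooth \<open>\<mu>0 > 0\<close> sc conv])
  also have "F (backtrack F y d \<alpha> \<epsilon>) \<le> F y"
    by (rule backtrack_le)
  also have "F y \<le> F x"
    unfolding F_def y_def by (rule prox_grad_decrease[OF smooth L(2) conv])
  \<comment> \<open>The two decreases are inserted below the factor \<open>1 - \<mu>0 / L0\<close>.
    The resulting monotonicity conditions hold because it is nonnegative.\<close>
  finally show ?thesis
    using L by (simp add: F_def mult_left_mono)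
qed

theorem theorem2p18:
  fixes f0 g0 F0 :: "real^'n0 \<Rightarrow> real"
    and g :: "'n0 \<Rightarrow> real \<Rightarrow> real"
    and Q :: "real^'n1^'n0"
    and Rbar :: "real^'n0^'n1"
    and L0 \<mu>0 c \<epsilon> :: real
    and x :: "nat \<Rightarrow> real^'n0"
    and xstar :: "real^'n0"
  assumes "L_smooth L0 f0"
    and "\<mu>0 > 0" and "strongly_convex \<mu>0 f0"
    and "convex_on UNIV g0"
    and "\<And>u. g0 u = (\<Sum>i\<in>UNIV. g i (u $ i))"
    and "\<And>i. \<exists>p. \<forall>t. t \<noteq> p \<longrightarrow> g i differentiable (at t)"
    and "F0 = (\<lambda>u. f0 u + g0 u)"
    and "CARD('n1) \<le> CARD('n0)" and "rank Q = CARD('n1)"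
    and "c > 0" and "\<epsilon> > 0"
    and "\<And>k. k \<ge> 1 \<Longrightarrow> mgprox_step L0 f0 g0 g Q Rbar c \<epsilon> (x k) (x (k + 1))"
    and "xstar = argmin F0"
  shows "\<forall>k\<ge>1. F0 (x (k + 1)) - F0 xstar \<le> (1 - \<mu>0 / L0) ^ k * (F0 (x 1) - F0 xstar)"
proof (intro allI impI)
  fix k :: nat
  assume "k \<ge> 1"
  have contr: "F0 (x (j + 1)) - F0 xstar \<le> (1 - \<mu>0 / L0) * (F0 (x j) - F0 xstar)" if "j \<ge> 1" for j
    unfolding assms(7) by (rule mgprox_step_contraction[OF assms(1-4) assms(12)[OF that]])
  have "\<mu>0 \<le> L0" and "L0 > 0"
    using smooth_strongly_convex_le[OF assms(1,3)] assms(2) by auto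
  then have nonneg: "0 \<le> 1 - \<mu>0 / L0"
    by simp
  from \<open>k \<ge> 1\<close> show "F0 (x (k + 1)) - F0 xstar \<le> (1 - \<mu>0 / L0) ^ k * (F0 (x 1) - F0 xstar)"
  proof (induction k rule: dec_induct)
    case base
    show ?case
      using contr[of 1] by simp
  next
    case (step n)
    \<comment> \<open>The iterates are indexed from 1, so the exponent \<open>n\<close> belongs to
      \<open>x (n + 1)\<close>, and the next factor comes from the step at index
      \<open>Suc n\<close>.\<close>
    have "F0 (x (Suc n + 1)) - F0 xstar \<le> (1 - \<mu>0 / L0) * (F0 (x (n + 1)) - F0 xstar)"
      using contr[of "Suc n"]
      by simp
    also have "\<dots> \<le> (1 - \<mu>0 / L0) * ((1 - \<mu>0 / L0) ^ n * (F0 (x 1) - F0 xstar))"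
      using step.IH nonneg by (rule mult_left_mono)
    finally show ?case
      by (simp add: mult.assoc)
  qed
qed

end
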